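(* Consider the two-group Poisson model and the Bayes Oracle multiple testing rule described in the context, and suppose that, as $n\to\infty$: $p\to0$; $\alpha$ and $\delta$ are fixed and bounded away from both $0$ and infinity; and $\beta\propto p^{C_1}$ for some constant $C_1>1$. Let $t^{\mathrm{BO}}_1$ and $t^{\mathrm{BO}}_2$ be the type I and type II error probabilities of the Bayes Oracle for an individual test (they do not depend on the index $i$). Then $t^{\mathrm{BO}}_2=(\beta+\delta+1)^{-\alpha}$ for all sufficiently large $n$, $t^{\mathrm{BO}}_1=o(p)$ as $n\to\infty$, and the Bayes risk of the Bayes Oracle satisfies $$R^{\mathrm{BO}}_{\mathrm{Opt}}=np(\delta+1)^{-\alpha}(1+o_1(1)),$$ where $o_1(1)$ is non-random, independent of the index $i$, and tends to $0$ as $n\to\infty$.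
   Context: $Ga(\alpha_1,\alpha_2)$ is the Gamma distribution with shape $\alpha_1>0$ and scale $\alpha_2>0$, density $\frac{1}{\Gamma(\alpha_1)\alpha_2^{\alpha_1}}x^{\alpha_1-1}e^{-x/\alpha_2}$, $x>0$. $NB(\alpha,q)$ is the negative binomial distribution with size $\alpha>0$ and success probability $q$, with mass function $\binom{y+\alpha-1}{y}(1-q)^y q^{\alpha}$, $y=0,1,2,\dots$. Two-group model: $\nu_1,\dots,\nu_n$ are independent with $P(\nu_i=1)=p=1-P(\nu_i=0)$; given $\nu_i=0$, $\theta_i\sim Ga(\alpha,\beta)$; given $\nu_i=1$, $\theta_i\sim Ga(\alpha,\beta+\delta)$ (independently over $i$); given $\theta_i$, $Y_i$ is Poisson with mean $\theta_i$, independently. Hence marginally $Y_i\sim NB(\alpha,\frac1{\beta+1})$ under $H_{0i}:\nu_i=0$ and $Y_i\sim NB(\alpha,\frac{1}{\beta+\delta+1})$ under $H_{1i}:\nu_i=1$. The quantities $p=p_n$ and $\beta=\beta_n$ depend on $n$. Bayes risk: for a multiple testing rule (testing $H_{0i}$ against $H_{1i}$ for $i=1,\dots,n$) with type I error $t_{1i}=P_{H_{0i}}(H_{0i}\text{ rejected})$ and type II error $t_{2i}=P_{H_{1i}}(H_{0i}\text{ accepted})$, the Bayes risk under additive $0$-$1$ loss is $R=\sum_{i=1}^n[(1-p)t_{1i}+p\,t_{2i}]$. The Bayes Oracle is the rule minimizing $R$: it rejects $H_{0i}$ iff $f_{H_{1i}}(Y_i)/f_{H_{0i}}(Y_i)>(1-p)/p$,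 with $f_{H_{0i}},f_{H_{1i}}$ the marginal mass functions of $Y_i$; equivalently, it rejects $H_{0i}$ iff $Y_i>C$, where $$C=\frac{\log\big(\frac{1-p}{p}\big)+\alpha\log\big(\frac{\beta+\delta+1}{\beta+1}\big)}{\log\Big[\frac{(\beta+\delta)(\beta+1)}{\beta(\beta+\delta+1)}\Big]}.$$ *)

theory Defs
  imports "HOL-Probability.Probability" "HOL-Library.Landau_Symbols"
begin

text \<open>Shape \<open>a\<close> and scale \<open>b\<close>.\<close>

definition gamma_density :: "real \<Rightarrow> real \<Rightarrow> real \<Rightarrow> real" where
  "gamma_density a b x =
     (if 0 < x
      then 1 / (Gamma a * b powr a) * x powr (a - 1) * exp (- x / b)
      else 0)"

definition group_scale :: "real \<Rightarrow> real \<Rightarrow> bool \<Rightarrow> real" where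
  "group_scale \<beta> \<delta> v = (if v then \<beta> + \<delta> else \<beta>)"

abbreviation triple_space :: "(bool \<times> real \<times> nat) measure" where
  "triple_space \<equiv> count_space UNIV \<Otimes>\<^sub>M lborel \<Otimes>\<^sub>M count_space UNIV"

text \<open>Joint density of \<open>(\<nu>\<^sub>i, \<theta>\<^sub>i, Y\<^sub>i)\<close>: the law of \<open>\<nu>\<^sub>i\<close>, times that of \<open>\<theta>\<^sub>i\<close> given \<open>\<nu>\<^sub>i\<close>,
  times that of \<open>Y\<^sub>i\<close> given \<open>\<theta>\<^sub>i\<close>. The library leaves \<open>poisson_pmf t\<close> unspecified for \<open>t \<le> 0\<close>,
  where the Gamma factor is zero.\<close>

definition triple_density ::
  "real \<Rightarrow> real \<Rightarrow> real \<Rightarrow> real \<Rightarrow> bool \<times> real \<times> nat \<Rightarrow> real" where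
  "triple_density p \<alpha> \<beta> \<delta> = (\<lambda>(v, t, y).
     pmf (bernoulli_pmf p) v * gamma_density \<alpha> (group_scale \<beta> \<delta> v) t * pmf (poisson_pmf t) y)"

definition two_group_model ::
  "'a measure \<Rightarrow> nat \<Rightarrow> real \<Rightarrow> real \<Rightarrow> real \<Rightarrow> real \<Rightarrow>
   (nat \<Rightarrow> 'a \<Rightarrow> bool) \<Rightarrow> (nat \<Rightarrow> 'a \<Rightarrow> real) \<Rightarrow> (nat \<Rightarrow> 'a \<Rightarrow> nat) \<Rightarrow> bool" where
  "two_group_model M n p \<alpha> \<beta> \<delta> \<nu> \<theta> Y \<longleftrightarrow>
     prob_space M \<and>
     prob_space.indep_vars M (\<lambda>_. triple_space) (\<lambda>i \<omega>. (\<nu> i \<omega>, \<theta> i \<omega>, Y i \<omega>)) {1..n} \<and>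
     (\<forall>i\<in>{1..n}. distributed M triple_space (\<lambda>\<omega>. (\<nu> i \<omega>, \<theta> i \<omega>, Y i \<omega>))
        (\<lambda>x. ennreal (triple_density p \<alpha> \<beta> \<delta> x)))"

text \<open>A multiple testing rule maps the data \<open>(Y\<^sub>1, \<dots>, Y\<^sub>n)\<close> to the predicate
  ``\<open>H\<^sub>0\<^sub>i\<close> is rejected'' on indices \<open>i\<close>.\<close>

type_synonym testing_rule = "(nat \<Rightarrow> nat) \<Rightarrow> nat \<Rightarrow> bool"

definition rejects :: "testing_rule \<Rightarrow> nat \<Rightarrow> (nat \<Rightarrow> 'a \<Rightarrow> nat) \<Rightarrow> nat \<Rightarrow> 'a \<Rightarrow> bool" where
  "rejects rule n Y i \<omega> = rule (\<lambda>j\<in>{1..n}. Y j \<omega>) i"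

definition type_I_error ::
  "'a measure \<Rightarrow> nat \<Rightarrow> (nat \<Rightarrow> 'a \<Rightarrow> bool) \<Rightarrow> (nat \<Rightarrow> 'a \<Rightarrow> nat) \<Rightarrow> testing_rule \<Rightarrow> nat \<Rightarrow> real" where
  "type_I_error M n \<nu> Y rule i = \<P>(\<omega> in M. rejects rule n Y i \<omega> \<bar> \<not> \<nu> i \<omega>)"

definition type_II_error ::
  "'a measure \<Rightarrow> nat \<Rightarrow> (nat \<Rightarrow> 'a \<Rightarrow> bool) \<Rightarrow> (nat \<Rightarrow> 'a \<Rightarrow> nat) \<Rightarrow> testing_rule \<Rightarrow> nat \<Rightarrow> real" where
  "type_II_error M n \<nu> Y rule i = \<P>(\<omega> in M. \<not> rejects rule n Y i \<omega> \<bar> \<nu> i \<omega>)"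

definition bayes_risk ::
  "'a measure \<Rightarrow> nat \<Rightarrow> real \<Rightarrow> (nat \<Rightarrow> 'a \<Rightarrow> bool) \<Rightarrow> (nat \<Rightarrow> 'a \<Rightarrow> nat) \<Rightarrow> testing_rule \<Rightarrow> real" where
  "bayes_risk M n p \<nu> Y rule =
     (\<Sum>i=1..n. (1 - p) * type_I_error M n \<nu> Y rule i + p * type_II_error M n \<nu> Y rule i)"

text \<open>Marginal mass function of \<open>Y\<^sub>i\<close> when \<open>\<theta>\<^sub>i\<close> has the Gamma distribution with shape \<open>\<alpha>\<close>
  and scale \<open>b\<close>; this is the negative binomial mass function with size \<open>\<alpha>\<close> and success probability
  \<open>1 / (b + 1)\<close>.\<close>

definition marginal_mass :: "real \<Rightarrow> real \<Rightarrow> nat \<Rightarrow> real" where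
  "marginal_mass \<alpha> b y =
     (\<integral>t. gamma_density \<alpha> b t * pmf (poisson_pmf t) y \<partial>lborel)"

definition bayes_oracle :: "real \<Rightarrow> real \<Rightarrow> real \<Rightarrow> real \<Rightarrow> testing_rule" where
  "bayes_oracle p \<alpha> \<beta> \<delta> y i \<longleftrightarrow>
     marginal_mass \<alpha> (group_scale \<beta> \<delta> True) (y i) / marginal_mass \<alpha> (group_scale \<beta> \<delta> False) (y i)
       > (1 - p) / p"

end

theory Submission
  imports Defs
begin

text \<open>
  Mixing the Poisson law over a Gamma density with scale \<open>b\<close> gives
  \<open>K\<^sub>y (b + 1) powr (- \<alpha>) (b / (b + 1)) ^ y\<close> with a factor \<open>K\<^sub>y\<close> that does not depend on \<open>b\<close>.
  The likelihood ratio at \<open>y\<close> is therefore geometric, \<open>K A ^ y\<close> with \<open>K \<le> 1 \<le> A\<close>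
  (\<open>marginal_mass_ratio\<close>). When \<open>p < 1/2\<close> the value \<open>y = 0\<close> is never rejected, because
  \<open>K \<le> 1 < (1 - p) / p\<close>. At \<open>y = 1\<close> the ratio is \<open>G \<beta> / \<beta>\<close> for a function \<open>G\<close>
  with a positive limit at \<open>0\<close>. Since \<open>\<beta>\<close> is of order \<open>p powr C1\<close> with \<open>C1 > 1\<close>, \<open>\<beta> / p \<longlonglongrightarrow> 0\<close>, so the
  ratio eventually exceeds \<open>1 / p\<close>, and then does so for all \<open>y \<ge> 1\<close>. Thus the oracle eventually
  rejects exactly when \<open>Y\<^sub>i \<noteq> 0\<close> (\<open>rejection_region_eq\<close>).

  From that point on the type II error is the probability of a zero count under scale \<open>\<beta> + \<delta>\<close>,
  which is \<open>(\<beta> + \<delta> + 1) powr (- \<alpha>)\<close>, and the type I error is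
  \<open>1 - (\<beta> + 1) powr (- \<alpha>) \<le> \<alpha> \<beta>\<close>, which is \<open>o(p)\<close>. The first tends to
  \<open>(\<delta> + 1) powr (- \<alpha>)\<close> and dominates the second in the risk
  \<open>n ((1 - p) t\<^sub>1 + p t\<^sub>2)\<close>. The passage from the model to these probabilities is
  \<open>emeasure_triple_law\<close>: Fubini's theorem on the joint density of group, mean and count.
\<close>

section \<open>Gamma mixtures of Poisson laws\<close>

lemma nn_integral_Gamma_kernel:
  fixes s c :: real
  assumes s: "s > 0" and c: "c > 0"
  shows "(\<integral>\<^sup>+t. ennreal (if 0 < t then t powr (s - 1) * exp (- (c * t)) else 0) \<partial>lborel) =
    ennreal (Gamma s / c powr s)" (is "?I = _")
proof -
  have "ennreal (Gamma s) =
      (\<integral>\<^sup>+t. ennreal (indicator {0..} t * t powr (s - 1) / exp t) \<partial>lborel)"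
    by (rule Gamma_conv_nn_integral_real[OF s])
  also have "\<dots> = ennreal \<bar>c\<bar> *
      (\<integral>\<^sup>+t. ennreal (indicator {0..} (0 + c * t) * (0 + c * t) powr (s - 1) / exp (0 + c * t)) \<partial>lborel)"
    by (rule nn_integral_real_affine) (use c in auto)
  also have "(\<lambda>t. ennreal (indicator {0..} (0 + c * t) * (0 + c * t) powr (s - 1) / exp (0 + c * t))) =
      (\<lambda>t. ennreal (c powr (s - 1)) *
        ennreal (if 0 < t then t powr (s - 1) * exp (- (c * t)) else 0))"
    using c by (auto simp: fun_eq_iff powr_mult exp_minus field_simps zero_le_mult_iff
        ennreal_mult'[symmetric] split: split_indicator)
  also have "ennreal \<bar>c\<bar> * (\<integral>\<^sup>+t. ennreal (c powr (s - 1)) *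
        ennreal (if 0 < t then t powr (s - 1) * exp (- (c * t)) else 0) \<partial>lborel) =
      ennreal (c * c powr (s - 1)) * ?I"
    using c by (subst nn_integral_cmult) (auto simp: ennreal_mult' mult.assoc)
  also have "c * c powr (s - 1) = c powr s"
    using c by (simp add: powr_diff)
  finally have *: "ennreal (c powr s) * ?I = ennreal (Gamma s)" ..
  have "?I = ennreal (1 / c powr s) * (ennreal (c powr s) * ?I)"
    using c by (simp add: mult.assoc[symmetric] ennreal_mult'[symmetric])
  also have "\<dots> = ennreal (Gamma s / c powr s)"
    unfolding * using c by (simp add: ennreal_mult'[symmetric])
  finally show ?thesis .
qed

lemma gamma_density_nonneg: "a > 0 \<Longrightarrow> 0 \<le> gamma_density a b t"
  by (auto simp: gamma_density_def less_imp_le Gamma_real_pos)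

lemma gamma_density_times_poisson:
  assumes "a > 0" "b > 0"
  shows "gamma_density a b t * pmf (poisson_pmf t) y =
    1 / (Gamma a * b powr a * fact y) *
    (if 0 < t then t powr (a + real y - 1) * exp (- ((1 / b + 1) * t)) else 0)"
proof (cases "0 < t")
  case True
  then have "t powr (a + real y - 1) = t powr (a - 1) * t ^ y"
    by (simp add: powr_add[symmetric] powr_realpow[symmetric] algebra_simps)
  moreover have "exp (- ((1 / b + 1) * t)) = exp (- t / b) * exp (- t)"
    by (simp add: exp_add[symmetric] algebra_simps)
  ultimately show ?thesis
    using True by (simp add: gamma_density_def)
qed (simp add: gamma_density_def)

lemma measurable_gamma_density_times_poisson:
  assumes "a > 0" "b > 0"
  shows "(\<lambda>t. gamma_density a b t * pmf (poisson_pmf t) y) \<in> borel_measurable borel"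
  unfolding gamma_density_times_poisson[OF assms] by measurable

text \<open>The generalized binomial coefficient \<open>y + a - 1\<close> over \<open>y\<close>, in Gamma form.\<close>
definition nb_coeff :: "real \<Rightarrow> nat \<Rightarrow> real" where
  "nb_coeff a y = Gamma (a + real y) / (Gamma a * fact y)"

text \<open>The product of the two densities is again a Gamma kernel, with shape \<open>a + y\<close> and rate
  \<open>1 / b + 1\<close>, so Euler's integral evaluates the mixture.\<close>
lemma nn_integral_gamma_poisson:
  assumes a: "a > 0" and b: "b > 0"
  shows "(\<integral>\<^sup>+t. ennreal (gamma_density a b t * pmf (poisson_pmf t) y) \<partial>lborel) =
    ennreal (nb_coeff a y * (b + 1) powr (- a) * (b / (b + 1)) ^ y)"
proof -
  have pos: "0 \<le> 1 / (Gamma a * b powr a * fact y)"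
    using a by (simp add: Gamma_real_pos less_imp_le)
  have "b powr a * (1 / b + 1) powr (a + real y) = (b + 1) powr a * ((b + 1) / b) ^ y"
  proof -
    have "1 / b + 1 = (b + 1) / b"
      using b by (simp add: field_simps)
    then show ?thesis
      using b by (simp add: powr_add powr_realpow powr_divide power_divide)
  qed
  then have prod: "b powr a * fact y * (1 / b + 1) powr (a + real y) =
      fact y * ((b + 1) powr a * ((b + 1) / b) ^ y)"
    by simp
  have "1 / (Gamma a * b powr a * fact y) * (Gamma (a + real y) / (1 / b + 1) powr (a + real y)) =
      Gamma (a + real y) / (Gamma a * (b powr a * fact y * (1 / b + 1) powr (a + real y)))"
    by (simp add: mult_ac)
  also have "\<dots> = nb_coeff a y * (b + 1) powr (- a) * (b / (b + 1)) ^ y"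
    unfolding prod using b by (simp add: nb_coeff_def powr_minus_divide power_divide mult_ac)
  finally have eq: "1 / (Gamma a * b powr a * fact y) *
      (Gamma (a + real y) / (1 / b + 1) powr (a + real y)) =
      nb_coeff a y * (b + 1) powr (- a) * (b / (b + 1)) ^ y" .
  have "(\<integral>\<^sup>+t. ennreal (gamma_density a b t * pmf (poisson_pmf t) y) \<partial>lborel) =
      ennreal (1 / (Gamma a * b powr a * fact y)) *
      (\<integral>\<^sup>+t. ennreal (if 0 < t then t powr (a + real y - 1) * exp (- ((1 / b + 1) * t)) else 0) \<partial>lborel)"
    unfolding gamma_density_times_poisson[OF assms] ennreal_mult'[OF pos]
    by (rule nn_integral_cmult) measurable
  also have "\<dots> = ennreal (1 / (Gamma a * b powr a * fact y)) *
      ennreal (Gamma (a + real y) / (1 / b + 1) powr (a + real y))"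
    using a b by (subst nn_integral_Gamma_kernel) (auto intro: add_pos_pos)
  finally show ?thesis
    unfolding ennreal_mult'[OF pos, symmetric] eq .
qed

lemma marginal_mass_eq:
  assumes a: "a > 0" and b: "b > 0"
  shows "marginal_mass a b y = nb_coeff a y * (b + 1) powr (- a) * (b / (b + 1)) ^ y"
proof -
  have "0 \<le> nb_coeff a y * (b + 1) powr (- a) * (b / (b + 1)) ^ y"
    using a b by (simp add: nb_coeff_def Gamma_real_pos less_imp_le add_pos_nonneg)
  then show ?thesis
    unfolding marginal_mass_def using a measurable_gamma_density_times_poisson[OF assms]
    by (subst integral_eq_nn_integral) (auto simp: gamma_density_nonneg nn_integral_gamma_poisson assms)
qed

lemma nn_integral_gamma_density:
  assumes a: "a > 0" and b: "b > 0"
  shows "(\<integral>\<^sup>+t. ennreal (gamma_density a b t) \<partial>lborel) = 1"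
proof -
  have pos: "0 \<le> 1 / (Gamma a * b powr a)"
    using a by (simp add: Gamma_real_pos less_imp_le)
  have "(\<lambda>t. ennreal (gamma_density a b t)) = (\<lambda>t. ennreal (1 / (Gamma a * b powr a)) *
      ennreal (if 0 < t then t powr (a - 1) * exp (- (1 / b * t)) else 0))"
    by (auto simp: fun_eq_iff gamma_density_def ennreal_mult'[OF pos, symmetric])
  then have "(\<integral>\<^sup>+t. ennreal (gamma_density a b t) \<partial>lborel) =
      ennreal (1 / (Gamma a * b powr a)) * ennreal (Gamma a / (1 / b) powr a)"
    using a b by (simp add: nn_integral_cmult nn_integral_Gamma_kernel del: times_divide_eq_left)
  also have "\<dots> = 1"
    unfolding ennreal_mult'[OF pos, symmetric] using a b Gamma_real_pos[OF a]
    by (simp add: powr_divide less_imp_neq[symmetric])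
  finally show ?thesis .
qed

section \<open>The law of a single observation\<close>

definition triple_law :: "real \<Rightarrow> real \<Rightarrow> real \<Rightarrow> real \<Rightarrow> (bool \<times> real \<times> nat) measure" where
  "triple_law p \<alpha> \<beta> \<delta> = density triple_space (\<lambda>x. ennreal (triple_density p \<alpha> \<beta> \<delta> x))"

definition group_event :: "bool \<Rightarrow> nat set \<Rightarrow> (bool \<times> real \<times> nat) set" where
  "group_event v S = {v} \<times> UNIV \<times> S"

lemma space_triple_space: "space triple_space = UNIV"
  by (simp add: space_pair_measure)

lemma sets_group_event: "group_event v S \<in> sets triple_space"
  unfolding group_event_def by (intro pair_measureI) auto

lemma measurable_triple_density:
  assumes "\<alpha> > 0" "\<beta> > 0" "\<delta> > 0"
  shows "triple_density p \<alpha> \<beta> \<delta> \<in> borel_measurable triple_space"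
proof (rule measurable_pair_measure_countable1)
  fix v :: bool
  have g: "group_scale \<beta> \<delta> v > 0"
    using assms by (simp add: group_scale_def)
  have "(\<lambda>x. pmf (bernoulli_pmf p) v *
      (gamma_density \<alpha> (group_scale \<beta> \<delta> v) (fst x) * pmf (poisson_pmf (fst x)) (snd x)))
    \<in> borel_measurable (lborel \<Otimes>\<^sub>M count_space UNIV)"
    unfolding gamma_density_times_poisson[OF \<open>\<alpha> > 0\<close> g] by measurable
  then show "(\<lambda>y. triple_density p \<alpha> \<beta> \<delta> (v, y)) \<in> borel_measurable (lborel \<Otimes>\<^sub>M count_space UNIV)"
    by (simp add: triple_density_def case_prod_unfold mult.assoc)
qed simp

text \<open>The integral over \<open>y\<close> is taken innermost: there it turns the Poisson mass function into
  the Poisson probability of \<open>S\<close>. For \<open>S = UNIV\<close> this factor is \<open>1\<close> and only the total mass of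
  the Gamma density is left, so the negative binomial series never has to be summed.\<close>
lemma emeasure_triple_law:
  assumes "\<alpha> > 0" "\<beta> > 0" "\<delta> > 0"
  shows "emeasure (triple_law p \<alpha> \<beta> \<delta>) (group_event v S) =
    ennreal (pmf (bernoulli_pmf p) v) *
    (\<integral>\<^sup>+t. ennreal (gamma_density \<alpha> (group_scale \<beta> \<delta> v) t) * emeasure (poisson_pmf t) S \<partial>lborel)"
proof -
  note [measurable] = measurable_triple_density[OF assms] sets_group_event
  let ?w = "pmf (bernoulli_pmf p)" and ?g = "\<lambda>v. gamma_density \<alpha> (group_scale \<beta> \<delta> v)"
  let ?N = "count_space (UNIV :: nat set)"
  let ?f = "\<lambda>x. ennreal (triple_density p \<alpha> \<beta> \<delta> x) * indicator (group_event v S) x"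
  have N: "sigma_finite_measure ?N"
    by (rule sigma_finite_measure_count_space)
  have TN: "sigma_finite_measure ((lborel :: real measure) \<Otimes>\<^sub>M ?N)"
    using lborel.sigma_finite_measure_axioms N by (rule sigma_finite_pair_measure)
  have g: "group_scale \<beta> \<delta> v > 0"
    using assms by (simp add: group_scale_def)
  have meas2: "(\<lambda>z. ?f (u, z)) \<in> borel_measurable (lborel \<Otimes>\<^sub>M ?N)" for u
    by measurable
  have poisson: "ennreal (?g v t) * emeasure (poisson_pmf t) S =
      (\<integral>\<^sup>+y. ennreal (?g v t * pmf (poisson_pmf t) y) * indicator S y \<partial>?N)" for t
    using gamma_density_nonneg[OF \<open>\<alpha> > 0\<close>]
    by (simp add: ennreal_mult' mult.assoc nn_integral_cmult nn_integral_pmf[symmetric]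
        nn_integral_count_space_indicator[of S, symmetric])
  have inner: "(\<integral>\<^sup>+y. ?f (u, t, y) \<partial>?N) =
      indicator {v} u * (ennreal (?w v) * (ennreal (?g v t) * emeasure (poisson_pmf t) S))" for u t
  proof -
    have "?f (u, t, y) = indicator {v} u * (ennreal (?w v) *
        (ennreal (?g v t * pmf (poisson_pmf t) y) * indicator S y))" for y
      by (auto simp: triple_density_def group_event_def ennreal_mult' mult_ac split: split_indicator)
    then show ?thesis
      by (simp add: nn_integral_cmult poisson)
  qed
  have "emeasure (triple_law p \<alpha> \<beta> \<delta>) (group_event v S) = (\<integral>\<^sup>+x. ?f x \<partial>triple_space)"
    unfolding triple_law_def by (rule emeasure_density) measurable
  also have "\<dots> = (\<integral>\<^sup>+u. \<integral>\<^sup>+z. ?f (u, z) \<partial>(lborel \<Otimes>\<^sub>M ?N) \<partial>count_space UNIV)"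
    by (rule sigma_finite_measure.nn_integral_fst[OF TN, symmetric]) measurable
  also have "\<dots> = (\<integral>\<^sup>+u. \<integral>\<^sup>+t. \<integral>\<^sup>+y. ?f (u, t, y) \<partial>?N \<partial>lborel \<partial>count_space UNIV)"
    using sigma_finite_measure.nn_integral_fst[OF N meas2] by simp
  also have "\<dots> = (\<integral>\<^sup>+u. indicator {v} u *
      (\<integral>\<^sup>+t. ennreal (?w v) * (ennreal (?g v t) * emeasure (poisson_pmf t) S) \<partial>lborel) \<partial>count_space UNIV)"
    unfolding inner by (intro nn_integral_cong) (auto split: split_indicator)
  also have "\<dots> = (\<integral>\<^sup>+t. ennreal (?w v) * (ennreal (?g v t) * emeasure (poisson_pmf t) S) \<partial>lborel)"
    by (subst mult.commute) (simp add: nn_integral_indicator_singleton[of v] del: nn_integral_count_space_finite)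
  also have "\<dots> = ennreal (?w v) * (\<integral>\<^sup>+t. ennreal (?g v t) * emeasure (poisson_pmf t) S \<partial>lborel)"
  proof (rule nn_integral_cmult)
    have "(\<lambda>(t, y). ennreal (?g v t * pmf (poisson_pmf t) y) * indicator S y)
        \<in> borel_measurable (lborel \<Otimes>\<^sub>M ?N)"
      unfolding gamma_density_times_poisson[OF \<open>\<alpha> > 0\<close> g] by measurable
    from sigma_finite_measure.borel_measurable_nn_integral_fst[OF N this]
    show "(\<lambda>t. ennreal (?g v t) * emeasure (poisson_pmf t) S) \<in> borel_measurable lborel"
      unfolding poisson by simp
  qed
  finally show ?thesis .
qed

lemma measure_triple_law_group:
  assumes "\<alpha> > 0" "\<beta> > 0" "\<delta> > 0"
  shows "measure (triple_law p \<alpha> \<beta> \<delta>) (group_event v UNIV) = pmf (bernoulli_pmf p) v"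
    and "measure (triple_law p \<alpha> \<beta> \<delta>) (group_event v {0}) =
      pmf (bernoulli_pmf p) v * (group_scale \<beta> \<delta> v + 1) powr (- \<alpha>)"
    and "measure (triple_law p \<alpha> \<beta> \<delta>) (group_event v (- {0})) =
      pmf (bernoulli_pmf p) v * (1 - (group_scale \<beta> \<delta> v + 1) powr (- \<alpha>))"
proof -
  let ?L = "triple_law p \<alpha> \<beta> \<delta>" and ?b = "group_scale \<beta> \<delta> v"
  have b: "?b > 0"
    using assms by (simp add: group_scale_def)
  have all: "emeasure ?L (group_event v UNIV) = ennreal (pmf (bernoulli_pmf p) v)"
    unfolding emeasure_triple_law[OF assms]
    using nn_integral_gamma_density[OF \<open>\<alpha> > 0\<close> b] measure_pmf.emeasure_space_1 by simp
  then show 1: "measure ?L (group_event v UNIV) = pmf (bernoulli_pmf p) v"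
    by (simp add: measure_def)
  have "emeasure ?L (group_event v {0}) =
      ennreal (pmf (bernoulli_pmf p) v * (?b + 1) powr (- \<alpha>))"
    unfolding emeasure_triple_law[OF assms]
    using nn_integral_gamma_poisson[OF \<open>\<alpha> > 0\<close> b, of 0] Gamma_real_pos[OF \<open>\<alpha> > 0\<close>]
      gamma_density_nonneg[OF \<open>\<alpha> > 0\<close>]
    by (simp add: emeasure_pmf_single ennreal_mult' nb_coeff_def less_imp_neq[symmetric])
  then show 2: "measure ?L (group_event v {0}) = pmf (bernoulli_pmf p) v * (?b + 1) powr (- \<alpha>)"
    by (simp add: measure_def)
  have "group_event v (- {0}) = group_event v UNIV - group_event v {0}"
    by (auto simp: group_event_def)
  moreover have "measure ?L (group_event v UNIV - group_event v {0}) =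
      measure ?L (group_event v UNIV) - measure ?L (group_event v {0})"
    using all by (intro measure_Diff) (auto simp: triple_law_def sets_group_event, auto simp: group_event_def)
  ultimately show "measure ?L (group_event v (- {0})) =
      pmf (bernoulli_pmf p) v * (1 - (?b + 1) powr (- \<alpha>))"
    using 1 2 by (simp add: algebra_simps)
qed

section \<open>Error probabilities of the oracle\<close>

definition rejection_region :: "real \<Rightarrow> real \<Rightarrow> real \<Rightarrow> real \<Rightarrow> nat set" where
  "rejection_region p \<alpha> \<beta> \<delta> =
     {y. marginal_mass \<alpha> (\<beta> + \<delta>) y / marginal_mass \<alpha> \<beta> y > (1 - p) / p}"

text \<open>The error probabilities are written through the law of one observation, so that their
  independence of the index and of the underlying probability space is built in.\<close>
definition oracle_type_I :: "real \<Rightarrow> real \<Rightarrow> real \<Rightarrow> real \<Rightarrow> real" where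
  "oracle_type_I p \<alpha> \<beta> \<delta> =
     measure (triple_law p \<alpha> \<beta> \<delta>) (group_event False (rejection_region p \<alpha> \<beta> \<delta>)) /
     measure (triple_law p \<alpha> \<beta> \<delta>) (group_event False UNIV)"

definition oracle_type_II :: "real \<Rightarrow> real \<Rightarrow> real \<Rightarrow> real \<Rightarrow> real" where
  "oracle_type_II p \<alpha> \<beta> \<delta> =
     measure (triple_law p \<alpha> \<beta> \<delta>) (group_event True (- rejection_region p \<alpha> \<beta> \<delta>)) /
     measure (triple_law p \<alpha> \<beta> \<delta>) (group_event True UNIV)"

lemma prob_group_event:
  assumes "two_group_model M n p \<alpha> \<beta> \<delta> \<nu> \<theta> Y" "i \<in> {1..n}"
  shows "\<P>(\<omega> in M. \<nu> i \<omega> = v \<and> Y i \<omega> \<in> S) = measure (triple_law p \<alpha> \<beta> \<delta>) (group_event v S)"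
proof -
  let ?X = "\<lambda>\<omega>. (\<nu> i \<omega>, \<theta> i \<omega>, Y i \<omega>)"
  have D: "distributed M triple_space ?X (\<lambda>x. ennreal (triple_density p \<alpha> \<beta> \<delta> x))"
    using assms unfolding two_group_model_def by blast
  have "measure (distr M triple_space ?X) (group_event v S) =
      measure M (?X -` group_event v S \<inter> space M)"
    using distributed_measurable[OF D] by (rule measure_distr) (rule sets_group_event)
  also have "?X -` group_event v S \<inter> space M = {\<omega> \<in> space M. \<nu> i \<omega> = v \<and> Y i \<omega> \<in> S}"
    by (auto simp: group_event_def)
  finally show ?thesis
    unfolding triple_law_def distributed_distr_eq_density[OF D] by simp
qed

lemma rejects_bayes_oracle:
  assumes "i \<in> {1..n}"
  shows "rejects (bayes_oracle p \<alpha> \<beta> \<delta>) n Y i \<omega> \<longleftrightarrow> Y i \<omega> \<in> rejection_region p \<alpha> \<beta> \<delta>"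
  using assms by (simp add: rejects_def bayes_oracle_def rejection_region_def group_scale_def)

lemma error_probs_oracle:
  assumes "two_group_model M n p \<alpha> \<beta> \<delta> \<nu> \<theta> Y" "i \<in> {1..n}"
  shows "type_I_error M n \<nu> Y (bayes_oracle p \<alpha> \<beta> \<delta>) i = oracle_type_I p \<alpha> \<beta> \<delta>"
    and "type_II_error M n \<nu> Y (bayes_oracle p \<alpha> \<beta> \<delta>) i = oracle_type_II p \<alpha> \<beta> \<delta>"
  using prob_group_event[OF assms, of False] prob_group_event[OF assms, of True]
    prob_group_event[OF assms, of False UNIV] prob_group_event[OF assms, of True UNIV]
  unfolding type_I_error_def type_II_error_def cond_prob_def oracle_type_I_def oracle_type_II_def
    rejects_bayes_oracle[OF \<open>i \<in> {1..n}\<close>]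
  by (simp_all add: conj_commute flip: Compl_iff)

section \<open>The rejection region\<close>

lemma marginal_mass_ratio:
  assumes "\<alpha> > 0" "\<beta> > 0" "\<delta> > 0"
  shows "marginal_mass \<alpha> (\<beta> + \<delta>) y / marginal_mass \<alpha> \<beta> y =
    ((\<beta> + 1) / (\<beta> + \<delta> + 1)) powr \<alpha> * ((\<beta> + \<delta>) * (\<beta> + 1) / (\<beta> * (\<beta> + \<delta> + 1))) ^ y"
proof -
  have "nb_coeff \<alpha> y > 0"
    using assms by (simp add: nb_coeff_def Gamma_real_pos add_pos_nonneg)
  moreover have "(\<beta> + \<delta>) * (\<beta> + 1) / (\<beta> * (\<beta> + \<delta> + 1)) =
      ((\<beta> + \<delta>) / (\<beta> + \<delta> + 1)) / (\<beta> / (\<beta> + 1))"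
    by simp
  ultimately show ?thesis
    using assms
    by (simp add: marginal_mass_eq powr_divide powr_minus_divide power_divide[of _ "_ / _"]
        del: divide_divide_eq_left divide_divide_eq_right)
      (simp add: divide_simps)
qed

text \<open>The right-hand side of the last hypothesis is \<open>\<beta>\<close> times the likelihood ratio at \<open>1\<close>. In
  this form both sides have a limit as \<open>\<beta> \<longlonglongrightarrow> 0\<close>, whereas the ratio itself diverges.\<close>
lemma rejection_region_eq:
  assumes "\<alpha> > 0" "\<beta> > 0" "\<delta> > 0" and p: "0 < p" "p < 1 / 2"
    and small: "\<beta> / p < ((\<beta> + 1) / (\<beta> + \<delta> + 1)) powr \<alpha> * ((\<beta> + \<delta>) * (\<beta> + 1) / (\<beta> + \<delta> + 1))"
  shows "rejection_region p \<alpha> \<beta> \<delta> = - {0}"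
proof -
  define K where "K = ((\<beta> + 1) / (\<beta> + \<delta> + 1)) powr \<alpha>"
  define A where "A = (\<beta> + \<delta>) * (\<beta> + 1) / (\<beta> * (\<beta> + \<delta> + 1))"
  have ratio: "marginal_mass \<alpha> (\<beta> + \<delta>) y / marginal_mass \<alpha> \<beta> y = K * A ^ y" for y
    unfolding K_def A_def using assms by (intro marginal_mass_ratio)
  have K: "0 < K" "K \<le> 1"
    using assms unfolding K_def by (auto intro!: powr_le1)
  have A: "1 \<le> A"
  proof -
    have "0 < \<beta> * (\<beta> + \<delta> + 1)"
      using \<open>\<beta> > 0\<close> \<open>\<delta> > 0\<close> by simp
    then show ?thesis
      unfolding A_def using \<open>\<delta> > 0\<close>
      by (subst le_divide_eq_1_pos) (simp_all add: distrib_left distrib_right)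
  qed
  have zero: "K \<le> (1 - p) / p"
  proof -
    have "1 \<le> (1 - p) / p"
      using p by (simp add: le_divide_eq)
    then show ?thesis
      using K by linarith
  qed
  have pos: "(1 - p) / p < K * A ^ y" if "y \<noteq> 0" for y
  proof -
    have "(1 - p) / p < 1 / p"
      using p by (intro divide_strict_right_mono) auto
    also have "1 / p = (\<beta> / p) / \<beta>"
      using \<open>\<beta> > 0\<close> by simp
    also have "\<dots> < (K * ((\<beta> + \<delta>) * (\<beta> + 1) / (\<beta> + \<delta> + 1))) / \<beta>"
      using small \<open>\<beta> > 0\<close> unfolding K_def by (intro divide_strict_right_mono) auto
    also have "\<dots> = K * A ^ 1"
      by (simp add: A_def)
    also have "\<dots> \<le> K * A ^ y"
      using K A that by (intro mult_left_mono power_increasing) auto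
    finally show ?thesis .
  qed
  have "y \<in> rejection_region p \<alpha> \<beta> \<delta> \<longleftrightarrow> y \<noteq> 0" for y
    unfolding rejection_region_def ratio mem_Collect_eq
    using zero pos[of y] by (cases "y = 0") auto
  then show ?thesis
    by auto
qed

text \<open>The type I error is linear in \<open>\<beta>\<close> to leading order; the bound follows from
  \<open>exp u \<ge> 1 + u\<close> at \<open>u = - a ln (x + 1)\<close> and \<open>ln (x + 1) \<le> x\<close>.\<close>
lemma one_minus_powr_le:
  fixes a x :: real
  assumes "0 \<le> a" "0 \<le> x"
  shows "1 - (x + 1) powr (- a) \<le> a * x"
proof -
  have "1 - a * x \<le> 1 + (- a * ln (x + 1))"
    using assms ln_add_one_self_le_self[of x] by (simp add: mult_left_mono add.commute)
  also have "\<dots> \<le> (x + 1) powr (- a)"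
    using assms exp_ge_add_one_self[of "- a * ln (x + 1)"] by (simp add: powr_def)
  finally show ?thesis
    by simp
qed

section \<open>Asymptotic risk\<close>

theorem mainTheorem3:
  fixes M :: "nat \<Rightarrow> 'a measure"
    and \<nu> :: "nat \<Rightarrow> nat \<Rightarrow> 'a \<Rightarrow> bool"
    and \<theta> :: "nat \<Rightarrow> nat \<Rightarrow> 'a \<Rightarrow> real"
    and Y :: "nat \<Rightarrow> nat \<Rightarrow> 'a \<Rightarrow> nat"
    and p \<beta> :: "nat \<Rightarrow> real"
    and \<alpha> \<delta> C1 :: real
  assumes p_range: "\<And>n. 0 < p n \<and> p n < 1"
    and p_lim: "p \<longlonglongrightarrow> 0"
    and "\<alpha> > 0" and "\<delta> > 0" and "C1 > 1"
    and \<beta>_prop: "\<exists>c>0. \<forall>n. \<beta> n = c * p n powr C1"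
    and model: "\<And>n. two_group_model (M n) n (p n) \<alpha> (\<beta> n) \<delta> (\<nu> n) (\<theta> n) (Y n)"
  shows "\<exists>t1 t2 o1 :: nat \<Rightarrow> real.
      (\<forall>n. \<forall>i\<in>{1..n}.
          type_I_error (M n) n (\<nu> n) (Y n) (bayes_oracle (p n) \<alpha> (\<beta> n) \<delta>) i = t1 n \<and>
          type_II_error (M n) n (\<nu> n) (Y n) (bayes_oracle (p n) \<alpha> (\<beta> n) \<delta>) i = t2 n) \<and>
      (\<forall>\<^sub>F n in sequentially. t2 n = (\<beta> n + \<delta> + 1) powr (- \<alpha>)) \<and>
      t1 \<in> o(p) \<and>
      o1 \<longlonglongrightarrow> 0 \<and>
      (\<forall>n. bayes_risk (M n) n (p n) (\<nu> n) (Y n) (bayes_oracle (p n) \<alpha> (\<beta> n) \<delta>) =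
             real n * p n * (\<delta> + 1) powr (- \<alpha>) * (1 + o1 n))"
proof -
  obtain c where c: "c > 0" and \<beta>_eq: "\<And>n. \<beta> n = c * p n powr C1"
    using \<beta>_prop by blast
  have p_pos: "0 < p n" and p_less: "p n < 1" for n
    using p_range by auto
  have \<beta>_pos: "\<beta> n > 0" for n
    using c p_pos[of n] by (simp add: \<beta>_eq)
  define G where "G b = ((b + 1) / (b + \<delta> + 1)) powr \<alpha> * ((b + \<delta>) * (b + 1) / (b + \<delta> + 1))" for b
  define t1 where "t1 n = oracle_type_I (p n) \<alpha> (\<beta> n) \<delta>" for n
  define t2 where "t2 n = oracle_type_II (p n) \<alpha> (\<beta> n) \<delta>" for n
  \<comment> \<open>The risk identity is required for every \<open>n\<close>, which forces this value of the relative error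
    (for \<open>n > 0\<close>).\<close>
  define o1 where "o1 n = ((1 - p n) * (t1 n / p n) + t2 n) / (\<delta> + 1) powr (- \<alpha>) - 1" for n

  have "(\<lambda>n. c * p n powr (C1 - 1)) \<longlonglongrightarrow> c * 0"
    using \<open>C1 > 1\<close> p_pos
    by (intro tendsto_intros tendsto_zero_powrI[OF p_lim tendsto_const]) (auto intro!: always_eventually less_imp_le)
  moreover have "c * p n powr (C1 - 1) = \<beta> n / p n" for n
    using p_pos[of n] by (simp add: \<beta>_eq powr_diff)
  ultimately have \<beta>_over_p: "(\<lambda>n. \<beta> n / p n) \<longlonglongrightarrow> 0"
    by simp
  have "(\<lambda>n. \<beta> n / p n * p n) \<longlonglongrightarrow> 0 * 0"
    by (intro tendsto_mult \<beta>_over_p p_lim)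
  then have \<beta>_lim: "\<beta> \<longlonglongrightarrow> 0"
    using p_pos by (simp add: less_imp_neq[symmetric])

  have "(\<lambda>n. G (\<beta> n) - \<beta> n / p n) \<longlonglongrightarrow> G 0 - 0"
    unfolding G_def using \<open>\<delta> > 0\<close> by (intro tendsto_intros \<beta>_lim \<beta>_over_p) auto
  moreover have "G 0 > 0"
    using \<open>\<delta> > 0\<close> by (simp add: G_def)
  ultimately have "\<forall>\<^sub>F n in sequentially. 0 < G (\<beta> n) - \<beta> n / p n"
    by (intro order_tendstoD(1)) auto
  moreover have "\<forall>\<^sub>F n in sequentially. p n < 1 / 2"
    by (rule order_tendstoD(2)[OF p_lim]) simp
  ultimately have region: "\<forall>\<^sub>F n in sequentially. rejection_region (p n) \<alpha> (\<beta> n) \<delta> = - {0}"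
  proof eventually_elim
    case (elim n)
    then show ?case
      using \<beta>_pos[of n] p_pos[of n] \<open>\<alpha> > 0\<close> \<open>\<delta> > 0\<close>
      by (intro rejection_region_eq) (simp_all add: G_def)
  qed

  have t2_eq: "\<forall>\<^sub>F n in sequentially. t2 n = (\<beta> n + \<delta> + 1) powr (- \<alpha>)"
    using region
  proof eventually_elim
    case (elim n)
    then show ?case
      using measure_triple_law_group[OF \<open>\<alpha> > 0\<close> \<beta>_pos \<open>\<delta> > 0\<close>, of "p n" n True] p_pos[of n] p_less[of n]
      by (simp add: t2_def oracle_type_II_def group_scale_def)
  qed
  have t1_eq: "\<forall>\<^sub>F n in sequentially. t1 n = 1 - (\<beta> n + 1) powr (- \<alpha>)"
    using region
  proof eventually_elim
    case (elim n)
    then show ?case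
      using measure_triple_law_group[OF \<open>\<alpha> > 0\<close> \<beta>_pos \<open>\<delta> > 0\<close>, of "p n" n False] p_pos[of n] p_less[of n]
      by (simp add: t1_def oracle_type_I_def group_scale_def)
  qed

  have t1_over_p: "(\<lambda>n. t1 n / p n) \<longlonglongrightarrow> 0"
  proof (rule tendsto_sandwich[OF _ _ tendsto_const])
    show "\<forall>\<^sub>F n in sequentially. 0 \<le> t1 n / p n"
      using p_pos by (auto simp: t1_def oracle_type_I_def less_imp_le)
    show "\<forall>\<^sub>F n in sequentially. t1 n / p n \<le> \<alpha> * (\<beta> n / p n)"
      using t1_eq
    proof eventually_elim
      case (elim n)
      then show ?case
        using one_minus_powr_le[of \<alpha> "\<beta> n"] \<open>\<alpha> > 0\<close> \<beta>_pos[of n] p_pos[of n]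
        by (simp add: divide_right_mono)
    qed
    show "(\<lambda>n. \<alpha> * (\<beta> n / p n)) \<longlonglongrightarrow> 0"
      using tendsto_mult_left[OF \<beta>_over_p, of \<alpha>] by simp
  qed
  then have t1_small: "t1 \<in> o(p)"
    using p_pos by (intro smalloI_tendsto) (auto simp: less_imp_neq[symmetric])

  have "(\<lambda>n. (\<beta> n + \<delta> + 1) powr (- \<alpha>)) \<longlonglongrightarrow> (0 + \<delta> + 1) powr (- \<alpha>)"
    using \<open>\<delta> > 0\<close> by (intro tendsto_intros \<beta>_lim) auto
  then have t2_lim: "t2 \<longlonglongrightarrow> (\<delta> + 1) powr (- \<alpha>)"
    using t2_eq by (simp add: tendsto_cong)
  have "o1 \<longlonglongrightarrow> ((1 - 0) * 0 + (\<delta> + 1) powr (- \<alpha>)) / (\<delta> + 1) powr (- \<alpha>) - 1"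
    unfolding o1_def using \<open>\<delta> > 0\<close> by (intro tendsto_intros p_lim t1_over_p t2_lim) auto
  then have o1_lim: "o1 \<longlonglongrightarrow> 0"
    using \<open>\<delta> > 0\<close> by simp

  have errors: "type_I_error (M n) n (\<nu> n) (Y n) (bayes_oracle (p n) \<alpha> (\<beta> n) \<delta>) i = t1 n \<and>
      type_II_error (M n) n (\<nu> n) (Y n) (bayes_oracle (p n) \<alpha> (\<beta> n) \<delta>) i = t2 n"
    if "i \<in> {1..n}" for n i
    using error_probs_oracle[OF model that] by (simp add: t1_def t2_def)
  have risk: "bayes_risk (M n) n (p n) (\<nu> n) (Y n) (bayes_oracle (p n) \<alpha> (\<beta> n) \<delta>) =
      real n * p n * (\<delta> + 1) powr (- \<alpha>) * (1 + o1 n)" for n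
  proof -
    have "bayes_risk (M n) n (p n) (\<nu> n) (Y n) (bayes_oracle (p n) \<alpha> (\<beta> n) \<delta>) =
        (\<Sum>i=1..n. (1 - p n) * t1 n + p n * t2 n)"
      unfolding bayes_risk_def using errors by (intro sum.cong) auto
    also have "\<dots> = real n * p n * ((1 - p n) * (t1 n / p n) + t2 n)"
      using p_pos[of n] by (simp add: field_simps)
    also have "\<dots> = real n * p n * (\<delta> + 1) powr (- \<alpha>) * (1 + o1 n)"
      using \<open>\<delta> > 0\<close> by (simp add: o1_def)
    finally show ?thesis .
  qed
  show ?thesis
    using errors t2_eq t1_small o1_lim risk by blast
qed

end
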